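(* For any fixed integers $j,k,m$ with $j\ge2$, define $\phi_{j,k,m}(n)=m(2^n-1)+k$ for $1\le n\le j$ and $\phi_{j,k,m}(n)=\left(\sum_{i=1}^j\phi_{j,k,m}(n-i)\right)-(j-1)k$ for $n>j$. Then $\Phi_1(\phi_{j,k,m},n)\equiv 0\pmod n$ for all positive integers $n$.
   Context: For an integer-valued function $\phi$ on the positive integers, $\Phi_1(\phi,n)=\sum_{d\mid n}\mu(d)\phi(n/d)$, where $\mu$ is the Möbius function; equivalently $\Phi_1(\phi,1)=\phi(1)$ and for $n=p_1^{k_1}\cdots p_r^{k_r}$ (distinct primes $p_i$) $\Phi_1(\phi,n)=\phi(n)-\sum_i\phi(n/p_i)+\sum_{i_1<i_2}\phi(n/(p_{i_1}p_{i_2}))-\cdots+(-1)^r\phi(n/(p_1\cdots p_r))$. *)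

theory Defs
  imports "HOL-Number_Theory.Number_Theory" "HOL-Computational_Algebra.Squarefree"
begin

definition moebius_mu :: "nat \<Rightarrow> int" where
  "moebius_mu n = (if squarefree n then (-1) ^ card (prime_factors n) else 0)"

definition Phi1 :: "(nat \<Rightarrow> int) \<Rightarrow> nat \<Rightarrow> int" where
  "Phi1 f n = (\<Sum>d | d dvd n. moebius_mu d * f (n div d))"

text \<open>Only the values at \<open>n \<ge> 1\<close> are meaningful: for \<open>n > j\<close> and \<open>1 \<le> i \<le> j\<close> one has
  \<open>n - i \<ge> 1\<close>, so the value at \<open>0\<close> is never used by the recursion.\<close>

function phi_seq :: "nat \<Rightarrow> int \<Rightarrow> int \<Rightarrow> nat \<Rightarrow> int" where
  "phi_seq j k m n =
     (if n \<le> j then m * (2 ^ n - 1) + k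
      else (\<Sum>i = 1..j. phi_seq j k m (n - i)) - (int j - 1) * k)"
  by pat_completeness auto
termination
  by (relation "measure (\<lambda>(j, k, m, n). n)") auto

declare phi_seq.simps [simp del]

end

theory Submission
  imports Defs "HOL-Computational_Algebra.Formal_Power_Series"
begin

text \<open>
  The sequence equals \<open>m L + k\<close>, where \<open>L\<close> is the case \<open>k = 0\<close>, \<open>m = 1\<close>, and the constant
  contributes \<open>k \<Sum>\<^sub>d \<mu>(d)\<close>, which is \<open>0\<close> for \<open>n > 1\<close>. The generating
  function of \<open>L\<close> is \<open>-X Q'/Q\<close> for \<open>Q = 1 - X - \<dots> - X\<^sup>j\<close>. Every integer power series with
  constant term \<open>1\<close> is an infinite product of factors \<open>(1 - X\<^sup>d)\<close> raised to integer powers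
  \<open>c\<^sub>d\<close>; taking \<open>-X\<close> times the logarithmic derivative gives \<open>L n = \<Sum>\<^sub>d\<^sub>|\<^sub>n d c\<^sub>d\<close>, and Moebius
  inversion turns this into \<open>\<Phi>\<^sub>1(L, n) = n c\<^sub>n\<close>.
\<close>

section \<open>Moebius inversion\<close>

lemma moebius_mu_prime_times:
  assumes "prime p" "\<not> p dvd d"
  shows "moebius_mu (p * d) = - moebius_mu d"
proof -
  have cop: "coprime p d"
    using assms by (simp add: prime_imp_coprime)
  have "d \<noteq> 0" "p \<noteq> 0"
    using assms by (auto intro: Nat.gr0I)
  then have "prime_factors (p * d) = insert p (prime_factors d)"
    using assms by (auto simp: prime_factors_product prime_prime_factors)
  moreover have "p \<notin> prime_factors d"
    using assms by auto
  moreover have "squarefree (p * d) \<longleftrightarrow> squarefree d"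
    using assms cop by (auto simp: squarefree_mult_coprime squarefree_prime dest: squarefree_multD)
  ultimately show ?thesis
    by (simp add: moebius_mu_def)
qed

text \<open>For a prime \<open>p\<close> dividing \<open>n\<close>, multiplication by
  \<open>p\<close> pairs the squarefree divisors prime to \<open>p\<close> (the set
  \<open>A\<close>) with those divisible by \<open>p\<close> (the set \<open>B\<close>), and paired
  terms have opposite signs.\<close>

lemma sum_moebius_mu_divisors:
  assumes "n > 0"
  shows "(\<Sum>d | d dvd n. moebius_mu d) = (if n = 1 then 1 else 0)"
proof (cases "n = 1")
  case True
  then show ?thesis by (simp add: moebius_mu_def)
next
  case False
  then obtain p where p: "prime p" "p dvd n"
    using prime_factor_nat by blast
  define A where "A = {d. d dvd n \<and> squarefree d \<and> \<not> p dvd d}"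
  define B where "B = {d. d dvd n \<and> squarefree d \<and> p dvd d}"
  have fin: "finite {d. d dvd n}"
    using assms by simp
  then have finAB: "finite A" "finite B"
    unfolding A_def B_def by (auto elim: finite_subset[rotated])
  have B: "B = (*) p ` A"
  proof (intro equalityI subsetI)
    fix d assume d: "d \<in> B"
    then obtain e where e: "d = p * e"
      by (auto simp: B_def)
    have "\<not> p dvd e"
    proof
      assume "p dvd e"
      then have "p ^ 2 dvd d"
        by (auto simp: e power2_eq_square)
      then show False
        using d p by (auto simp: B_def squarefree_def)
    qed
    then show "d \<in> (*) p ` A"
      using d unfolding e A_def B_def
      by (auto dest: squarefree_multD dvd_mult_right)
  next
    fix d assume "d \<in> (*) p ` A"
    then obtain e where e: "d = p * e" "e \<in> A"
      by auto
    then have "coprime p e"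
      using p by (auto simp: A_def prime_imp_coprime)
    then show "d \<in> B"
      using e p by (auto simp: A_def B_def squarefree_mult_coprime squarefree_prime intro: divides_mult)
  qed
  have "(\<Sum>d | d dvd n. moebius_mu d) = (\<Sum>d\<in>A \<union> B. moebius_mu d)"
    using fin by (intro sum.mono_neutral_right) (auto simp: A_def B_def moebius_mu_def)
  also have "\<dots> = (\<Sum>d\<in>A. moebius_mu d) + (\<Sum>d\<in>B. moebius_mu d)"
    using finAB by (intro sum.union_disjoint) (auto simp: A_def B_def)
  also have "(\<Sum>d\<in>B. moebius_mu d) = (\<Sum>d\<in>A. moebius_mu (p * d))"
    unfolding B using p by (subst sum.reindex) (auto simp: inj_on_def)
  also have "\<dots> = - (\<Sum>d\<in>A. moebius_mu d)"
    using p by (simp add: A_def moebius_mu_prime_times flip: sum_negf)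
  finally show ?thesis
    using False by simp
qed

text \<open>Moebius inversion: exchanging the two sums leaves the sum of \<open>moebius_mu\<close>
  over the divisors of \<open>n div e\<close>, which vanishes unless \<open>e = n\<close>. The
  divisor-sum form is assumed only up to \<open>n\<close>, which is all that a finite part of the
  product supplies.\<close>

lemma Phi1_divisor_sum:
  assumes "n > 0"
    and f: "\<And>i. 0 < i \<Longrightarrow> i \<le> n \<Longrightarrow> f i = (\<Sum>d | d dvd i. g d)"
  shows "Phi1 f n = g n"
proof -
  have fin: "finite {d. d dvd i}" if "i dvd n" for i
    using assms(1) that by (auto intro!: finite_divisors_nat Nat.gr0I)
  have "Phi1 f n = (\<Sum>d | d dvd n. \<Sum>e | e dvd n div d. moebius_mu d * g e)"
    unfolding Phi1_def
  proof (intro sum.cong refl)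
    fix d assume "d \<in> {d. d dvd n}"
    then have "0 < n div d" "n div d \<le> n"
      using assms(1) by (auto elim!: dvdE)
    then show "moebius_mu d * f (n div d) = (\<Sum>e | e dvd n div d. moebius_mu d * g e)"
      by (simp add: f sum_distrib_left)
  qed
  also have "\<dots> = (\<Sum>(d, e)\<in>(SIGMA d:{d. d dvd n}. {e. e dvd n div d}). moebius_mu d * g e)"
    using fin assms(1) by (intro sum.Sigma) auto
  \<comment> \<open>Both index sets describe the pairs with \<open>d * e dvd n\<close>, a condition
    symmetric in \<open>d\<close> and \<open>e\<close>.\<close>
  also have "(SIGMA d:{d. d dvd n}. {e. e dvd n div d}) =
      prod.swap ` (SIGMA e:{e. e dvd n}. {d. d dvd n div e})"
    using assms(1) by (auto simp: image_iff dvd_div_iff_mult mult.commute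
        intro: dvd_mult_left dvd_mult_right elim!: dvdE)
  also have "(\<Sum>(d, e)\<in>\<dots>. moebius_mu d * g e) =
      (\<Sum>(e, d)\<in>(SIGMA e:{e. e dvd n}. {d. d dvd n div e}). g e * moebius_mu d)"
    by (subst sum.reindex) (auto simp: case_prod_unfold mult.commute)
  also have "\<dots> = (\<Sum>e | e dvd n. g e * (\<Sum>d | d dvd n div e. moebius_mu d))"
    using fin assms(1) by (subst sum.Sigma [symmetric]) (auto simp: sum_distrib_left)
  also have "\<dots> = (\<Sum>e | e dvd n. if e = n then g n else 0)"
  proof (intro sum.cong refl)
    fix e assume "e \<in> {e. e dvd n}"
    then obtain r where "n = e * r" by auto
    then show "g e * (\<Sum>d | d dvd n div e. moebius_mu d) = (if e = n then g n else 0)"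
      using assms(1) by (subst sum_moebius_mu_divisors) auto
  qed
  also have "\<dots> = g n"
    using fin by (simp add: sum.delta)
  finally show ?thesis .
qed

section \<open>Logarithmic derivatives of integer power series\<close>

text \<open>\<open>A = -X P'/P\<close>, stated without division.\<close>

definition log_deriv :: "int fps \<Rightarrow> int fps \<Rightarrow> bool" where
  "log_deriv P A \<longleftrightarrow> - (fps_X * fps_deriv P) = A * P"

lemma log_deriv_mult:
  assumes "log_deriv P A" "log_deriv Q B"
  shows "log_deriv (P * Q) (A + B)"
proof -
  have "- (fps_X * fps_deriv (P * Q)) =
      (- (fps_X * fps_deriv P)) * Q + P * (- (fps_X * fps_deriv Q))"
    by (simp add: algebra_simps)
  also have "\<dots> = (A + B) * (P * Q)"
    using assms by (simp add: log_deriv_def algebra_simps)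
  finally show ?thesis
    by (simp add: log_deriv_def)
qed

lemma log_deriv_power:
  assumes "log_deriv P A"
  shows "log_deriv (P ^ k) (of_nat k * A)"
proof (induction k)
  case 0
  show ?case by (simp add: log_deriv_def)
next
  case (Suc k)
  show ?case
    using log_deriv_mult[OF assms Suc] by (simp add: algebra_simps)
qed

text \<open>Differentiate \<open>P * G = 1\<close>. The inverse enters as a witness
  \<open>G\<close>, so that negative exponents make sense over the integers.\<close>

lemma log_deriv_inverse:
  assumes "log_deriv P A" "P * G = 1"
  shows "log_deriv G (- A)"
proof -
  have "fps_deriv (P * G) = 0"
    using assms(2) by simp
  then have "P * fps_deriv G = - (fps_deriv P * G)"
    by (simp add: eq_neg_iff_add_eq_0)
  then have "- (fps_X * fps_deriv G) * P = fps_X * fps_deriv P * G"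
    by (simp add: algebra_simps)
  also have "\<dots> = - A * P * G"
    using assms(1) unfolding log_deriv_def
    by (metis minus_minus mult_minus_left)
  finally have "- (fps_X * fps_deriv G) * (P * G) = - A * G * (P * G)"
    by (simp add: algebra_simps)
  then show ?thesis
    using assms(2) by (simp add: log_deriv_def)
qed

text \<open>\<open>U\<close> is \<open>(1 - X^d)^c\<close>; for negative \<open>c\<close> it is a
  power of the geometric series \<open>G = 1 / (1 - X^d)\<close>.\<close>

lemma log_deriv_one_minus_X_power:
  fixes c :: int
  assumes "d > 0"
  shows "\<exists>U. fps_nth U 0 = 1 \<and>
    log_deriv U (Abs_fps (\<lambda>n. if 0 < n \<and> d dvd n then int d * c else 0))"
proof -
  define G :: "int fps" where "G = Abs_fps (\<lambda>n. if d dvd n then 1 else 0)"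
  define u :: "int fps" where "u = 1 - fps_X ^ d"
  \<comment> \<open>This is \<open>d X^d / (1 - X^d)\<close>, the case \<open>c = 1\<close>.\<close>
  define E :: "int fps" where "E = of_nat d * (G - 1)"
  have uG: "u * G = 1"
  proof (rule fps_ext)
    fix n
    show "fps_nth (u * G) n = fps_nth 1 n"
      using assms by (auto simp: u_def G_def algebra_simps fps_X_power_mult_nth dest: dvd_imp_le
          intro: dvd_diff_nat simp: dvd_minus_self)
  qed
  have "fps_X * fps_deriv u = - (of_nat d * fps_X ^ d)"
    using assms by (intro fps_ext) (auto simp: u_def fps_X_power_nth fps_of_nat [symmetric])
  moreover have "E * u = of_nat d * fps_X ^ d"
  proof -
    have "E * u = of_nat d * (u * G - u)"
      by (simp add: E_def algebra_simps)
    then show ?thesis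
      unfolding uG by (simp add: u_def)
  qed
  ultimately have u: "log_deriv u E"
    by (simp add: log_deriv_def)
  have E: "Abs_fps (\<lambda>n. if 0 < n \<and> d dvd n then int d * c else 0) = of_int c * E"
    by (rule fps_ext) (auto simp: E_def G_def fps_of_int [symmetric] fps_of_nat [symmetric])
  have u0: "fps_nth u 0 = 1" and G0: "fps_nth G 0 = 1"
    using assms by (auto simp: u_def G_def)
  show ?thesis
  proof (cases "c \<ge> 0")
    case True
    then have "log_deriv (u ^ nat c) (of_int c * E)"
      using log_deriv_power[OF u, of "nat c"] by simp
    moreover have "fps_nth (u ^ nat c) 0 = 1"
      using u0 by (simp add: fps_power_zeroth)
    ultimately show ?thesis
      unfolding E by blast
  next
    case False
    then have "log_deriv (G ^ nat (- c)) (of_int c * E)"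
      using log_deriv_power[OF log_deriv_inverse[OF u uG], of "nat (- c)"] by simp
    moreover have "fps_nth (G ^ nat (- c)) 0 = 1"
      using G0 by (simp add: fps_power_zeroth)
    ultimately show ?thesis
      unfolding E by blast
  qed
qed

text \<open>A finite stage of the product expansion, which avoids convergence questions:
  \<open>W\<close> is what remains of \<open>Q\<close> after dividing out the factors
  \<open>(1 - X^d)^(c d)\<close> with \<open>d \<le> N\<close>, and \<open>B\<close> is the
  contribution of \<open>W\<close> to \<open>L\<close>.\<close>

lemma log_deriv_divisor_sum_remainder:
  assumes "log_deriv Q L" "fps_nth Q 0 = 1"
  shows "\<exists>c W B. log_deriv W B \<and> fps_nth W 0 = 1 \<and> (\<forall>i\<le>N. fps_nth B i = 0) \<and>
    (\<forall>n>0. fps_nth L n = fps_nth B n + (\<Sum>d | d dvd n \<and> d \<le> N. int d * c d))"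
proof (induction N)
  case 0
  have "fps_nth L 0 = 0"
    using arg_cong[OF assms(1)[unfolded log_deriv_def], of "\<lambda>F. fps_nth F 0"] assms(2)
    by simp
  moreover have "{d. d dvd n \<and> d \<le> 0} = {}" if "n > 0" for n :: nat
    using that by auto
  ultimately show ?case
    using assms by (intro exI[of _ "\<lambda>_. 0"] exI[of _ Q] exI[of _ L]) auto
next
  case (Suc N)
  then obtain c W B where W: "log_deriv W B" "fps_nth W 0 = 1"
    and B: "\<And>i. i \<le> N \<Longrightarrow> fps_nth B i = 0"
    and L: "\<And>n. n > 0 \<Longrightarrow>
      fps_nth L n = fps_nth B n + (\<Sum>d | d dvd n \<and> d \<le> N. int d * c d)"
    by blast
  \<comment> \<open>As \<open>B\<close> vanishes up to \<open>N\<close>,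
    \<open>W = 1 + a X^(N+1) + ...\<close>. Multiplying by \<open>(1 - X^(N+1))^a\<close> cancels
    this coefficient, so the new exponent in \<open>c\<close> is \<open>- a\<close>.\<close>
  define a where "a = fps_nth W (Suc N)"
  \<comment> \<open>In the coefficient of \<open>B * W\<close> only the top coefficient of
    \<open>B\<close> times the constant term of \<open>W\<close> survives.\<close>
  have "- (int (Suc N) * a) = fps_nth (B * W) (Suc N)"
    using arg_cong[OF W(1)[unfolded log_deriv_def], of "\<lambda>F. fps_nth F (Suc N)"]
    by (simp add: a_def)
  also have "\<dots> = fps_nth B (Suc N)"
    using W(2) B by (simp add: fps_mult_nth)
  finally have BN: "fps_nth B (Suc N) = - (int (Suc N) * a)" by simp
  define E where "E = Abs_fps (\<lambda>n. if 0 < n \<and> Suc N dvd n then int (Suc N) * a else 0)"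
  obtain U where U: "fps_nth U 0 = 1" "log_deriv U E"
    unfolding E_def using log_deriv_one_minus_X_power[of "Suc N" a] by auto
  have "fps_nth (B + E) i = 0" if "i \<le> Suc N" for i
    using that B BN by (auto simp: E_def le_Suc_eq dest: dvd_imp_le)
  moreover have "fps_nth L n = fps_nth (B + E) n +
      (\<Sum>d | d dvd n \<and> d \<le> Suc N. int d * (c(Suc N := - a)) d)" if "n > 0" for n
  proof -
    have eq: "{d. d dvd n \<and> d \<le> Suc N} =
        (if Suc N dvd n then insert (Suc N) {d. d dvd n \<and> d \<le> N} else {d. d dvd n \<and> d \<le> N})"
      by (auto simp: le_Suc_eq)
    have "(\<Sum>d | d dvd n \<and> d \<le> N. int d * (c(Suc N := - a)) d) =
        (\<Sum>d | d dvd n \<and> d \<le> N. int d * c d)"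
      by (intro sum.cong) auto
    then show ?thesis
      using L[OF that] that unfolding eq by (simp add: E_def)
  qed
  moreover have "log_deriv (W * U) (B + E)"
    using W(1) U(2) by (rule log_deriv_mult)
  moreover have "fps_nth (W * U) 0 = 1"
    using W U by simp
  ultimately show ?case by blast
qed

text \<open>With the remainder taken at stage \<open>n\<close>, its coefficients vanish up to
  \<open>n\<close>, so inversion yields \<open>n * c n\<close> with an integer
  \<open>c n\<close>.\<close>

lemma dvd_Phi1_log_deriv:
  assumes "log_deriv Q L" "fps_nth Q 0 = 1" "n > 0"
  shows "int n dvd Phi1 (fps_nth L) n"
proof -
  obtain c B where B: "\<And>i. i \<le> n \<Longrightarrow> fps_nth B i = 0"
    and L: "\<And>i. i > 0 \<Longrightarrow>
      fps_nth L i = fps_nth B i + (\<Sum>d | d dvd i \<and> d \<le> n. int d * c d)"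
    using log_deriv_divisor_sum_remainder[OF assms(1,2), of n] by blast
  have "Phi1 (fps_nth L) n = int n * c n"
  proof (rule Phi1_divisor_sum[OF assms(3)])
    fix i assume i: "0 < i" "i \<le> n"
    then have "{d. d dvd i \<and> d \<le> n} = {d. d dvd i}"
      by (auto dest: dvd_imp_le)
    then show "fps_nth L i = (\<Sum>d | d dvd i. int d * c d)"
      using L[of i] B[of i] i by simp
  qed
  then show ?thesis by simp
qed

section \<open>The recurrence\<close>

text \<open>The correction \<open>(j - 1) * k\<close> reduces the \<open>j\<close> copies of
  \<open>k\<close> in the recurrence to one.\<close>

lemma phi_seq_affine: "phi_seq j k m n = m * phi_seq j 0 1 n + k"
proof (induction n rule: less_induct)
  case (less n)
  show ?case
  proof (cases "n \<le> j")
    case True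
    then show ?thesis by (simp add: phi_seq.simps)
  next
    case False
    have "phi_seq j k m n = (\<Sum>i = 1..j. phi_seq j k m (n - i)) - (int j - 1) * k"
      using False by (subst phi_seq.simps) simp
    also have "(\<Sum>i = 1..j. phi_seq j k m (n - i)) =
        (\<Sum>i = 1..j. m * phi_seq j 0 1 (n - i) + k)"
      using False by (intro sum.cong less) auto
    also have "\<dots> = m * (\<Sum>i = 1..j. phi_seq j 0 1 (n - i)) + int j * k"
      by (simp add: sum.distrib sum_distrib_left)
    also have "(\<Sum>i = 1..j. phi_seq j 0 1 (n - i)) = phi_seq j 0 1 n"
      using False by (subst (2) phi_seq.simps) simp
    finally show ?thesis by (simp add: algebra_simps)
  qed
qed

lemma sum_two_power_minus_one:
  "(\<Sum>i<n. 2 ^ i - 1 :: int) = 2 ^ n - 1 - int n"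
  by (induction n) auto

text \<open>Coefficientwise these are Newton's identities: for \<open>n \<le> j\<close> the initial
  values \<open>2^n - 1\<close> are exactly those that satisfy them, and for \<open>n > j\<close>
  they are the recurrence.\<close>

lemma log_deriv_phi_seq:
  "log_deriv (Abs_fps (\<lambda>n. if n = 0 then 1 else if n \<le> j then - 1 else 0))
     (Abs_fps (phi_seq j 0 1))"
    (is "log_deriv ?Q ?L")
  unfolding log_deriv_def
proof (rule fps_ext)
  fix n
  let ?q = "\<lambda>n. if n = 0 then 1 else if n \<le> j then - 1 else 0 :: int"
  let ?a = "phi_seq j 0 1"
  \<comment> \<open>The case \<open>i = 0\<close> is included: the value 0 there is the constant
    coefficient of the series.\<close>
  have small: "?a i = 2 ^ i - 1" if "i \<le> j" for i
    using that by (simp add: phi_seq.simps)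
  have "fps_nth (?L * ?Q) n = (\<Sum>i=0..n. ?q i * ?a (n - i))"
    by (subst mult.commute) (simp add: fps_mult_nth)
  also have "\<dots> = ?a n + (\<Sum>i=1..n. ?q i * ?a (n - i))"
    by (simp add: sum.atLeast_Suc_atMost)
  also have "(\<Sum>i=1..n. ?q i * ?a (n - i)) = - (\<Sum>i\<in>{1..n} \<inter> {..j}. ?a (n - i))"
    by (subst sum.inter_restrict) (auto simp flip: sum_negf intro!: sum.cong)
  also have "?a n + \<dots> = - (int n * ?q n)"
  proof (cases "n \<le> j")
    case True
    then have "{1..n} \<inter> {..j} = {1..n}" by auto
    moreover have "(\<Sum>i=1..n. ?a (n - i)) = (\<Sum>i<n. ?a i)"
      by (rule sum.reindex_bij_witness[of _ "\<lambda>i. n - i" "\<lambda>i. n - i"]) auto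
    moreover have "\<dots> = (\<Sum>i<n. 2 ^ i - 1)"
      using True by (intro sum.cong refl small) auto
    ultimately show ?thesis
      using True by (simp add: small sum_two_power_minus_one)
  next
    case False
    then have "{1..n} \<inter> {..j} = {1..j}" by auto
    then show ?thesis
      using False by (simp add: phi_seq.simps[of j 0 1 n])
  qed
  finally show "fps_nth (- (fps_X * fps_deriv ?Q)) n = fps_nth (?L * ?Q) n"
    by (cases n) auto
qed

theorem theorem4:
  fixes j n :: nat and k m :: int
  assumes "j \<ge> 2" and "n \<ge> 1"
  shows "[Phi1 (phi_seq j k m) n = 0] (mod (int n))"
proof -
  have "Phi1 (phi_seq j k m) n =
      m * Phi1 (phi_seq j 0 1) n + k * (\<Sum>d | d dvd n. moebius_mu d)"
    unfolding Phi1_def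
    by (subst phi_seq_affine) (simp add: algebra_simps sum.distrib sum_distrib_left)
  moreover have "int n dvd Phi1 (phi_seq j 0 1) n"
    using dvd_Phi1_log_deriv[OF log_deriv_phi_seq[of j]] assms(2) by (simp add: Abs_fps_inverse)
  \<comment> \<open>The sum is 0 for \<open>n > 1\<close>, and for \<open>n = 1\<close> divisibility
    is trivial.\<close>
  moreover have "int n dvd (\<Sum>d | d dvd n. moebius_mu d)"
    using assms(2) by (simp add: sum_moebius_mu_divisors)
  ultimately show ?thesis
    by (simp add: cong_0_iff)
qed

end
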